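(* Let $I\subseteq R=k[x_1,\ldots,x_n]$ be a nonzero proper squarefree monomial ideal with $\text{big-height}(I)=e$. Then $$\widehat\alpha(I)\ \ge\ \frac{\alpha(I)+e-1}{e}.$$
   Context: $k$ is an algebraically closed field of any characteristic. A squarefree monomial ideal is an ideal generated by squarefree monomials. The big-height of $I$ is the maximum of the heights of the primes $P\in\mathrm{Ass}(I)$. For a nonzero homogeneous ideal $J\subseteq R$: $\alpha(J)=\min\{d\mid J_d\neq 0\}$ is the smallest degree of a nonzero element of $J$; the $m$-th symbolic power is $J^{(m)}=\bigcap_{P\in \mathrm{Ass}(J)}(J^mR_P\cap R)$; the Waldschmidt constant is $\widehat\alpha(J)=\lim_{m\to\infty}\alpha(J^{(m)})/m$ (the limit exists). *)

theory Defs
  imports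
    Complex_Main
    "HOL-Library.Poly_Mapping"
    "HOL-Library.Extended_Nat"
    "HOL-Computational_Algebra.Polynomial"
    "HOL-Computational_Algebra.Fraction_Field"
    "HOL-Algebra.Ideal_Product"
begin

text \<open>An exponent vector \<open>t :: nat \<Rightarrow>\<^sub>0 nat\<close> stands for the monomial \<open>\<Prod>i. x\<^sub>i ^ lookup t i\<close>. The
  polynomial ring in \<open>n\<close> variables, indexed from \<open>0\<close> to \<open>n - 1\<close>, is the subring of
  \<open>(nat \<Rightarrow>\<^sub>0 nat) \<Rightarrow>\<^sub>0 'k\<close> of the polynomials in which no other variable occurs.\<close>

type_synonym 'k mpoly = "(nat \<Rightarrow>\<^sub>0 nat) \<Rightarrow>\<^sub>0 'k"

definition monomials :: "nat \<Rightarrow> (nat \<Rightarrow>\<^sub>0 nat) set" where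
  "monomials n = {t. Poly_Mapping.keys t \<subseteq> {..<n}}"

definition poly_ring :: "nat \<Rightarrow> ('k::comm_ring_1) mpoly ring" where
  "poly_ring n = \<lparr>carrier = {f. Poly_Mapping.keys f \<subseteq> monomials n},
     mult = (*), one = 1, zero = 0, add = (+)\<rparr>"

definition monom_degree :: "(nat \<Rightarrow>\<^sub>0 nat) \<Rightarrow> nat" where
  "monom_degree t = (\<Sum>i\<in>Poly_Mapping.keys t. Poly_Mapping.lookup t i)"

definition squarefree_monomials :: "nat \<Rightarrow> (nat \<Rightarrow>\<^sub>0 nat) set" where
  "squarefree_monomials n = {t \<in> monomials n. \<forall>i. Poly_Mapping.lookup t i \<le> 1}"

definition squarefree_monomial_ideal :: "nat \<Rightarrow> ('k::comm_ring_1) mpoly set \<Rightarrow> bool" where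
  "squarefree_monomial_ideal n I \<longleftrightarrow>
     (\<exists>S \<subseteq> squarefree_monomials n.
        I = Idl\<^bsub>poly_ring n\<^esub> ((\<lambda>t. Poly_Mapping.single t 1) ` S))"

text \<open>\<open>\<alpha>(J)\<close>; only meaningful for a nonzero homogeneous ideal \<open>J\<close>.\<close>

definition graded_part :: "('k::zero) mpoly set \<Rightarrow> nat \<Rightarrow> 'k mpoly set" where
  "graded_part J d = {f \<in> J. \<forall>t\<in>Poly_Mapping.keys f. monom_degree t = d}"

definition initial_degree :: "('k::zero) mpoly set \<Rightarrow> nat" where
  "initial_degree J = (LEAST d. graded_part J d \<noteq> {0})"

text \<open>\<open>Ass(I)\<close> is the set of associated primes of the module \<open>R/I\<close>: the primes that are the
  annihilator of the class of some \<open>r\<close> in \<open>R/I\<close>.\<close>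

definition associated_primes :: "('a, 'b) ring_scheme \<Rightarrow> 'a set \<Rightarrow> 'a set set" where
  "associated_primes R I =
     {P. primeideal P R \<and> (\<exists>r\<in>carrier R. P = {a \<in> carrier R. a \<otimes>\<^bsub>R\<^esub> r \<in> I})}"

definition height :: "('a, 'b) ring_scheme \<Rightarrow> 'a set \<Rightarrow> enat" where
  "height R P = (SUP h \<in> {h::nat. \<exists>Q. (\<forall>i\<le>h. primeideal (Q i) R) \<and>
     (\<forall>i<h. Q i \<subset> Q (Suc i)) \<and> Q h = P}. enat h)"

text \<open>A finite supremum of a nonempty set in \<^typ>\<open>enat\<close> is attained, so this is a maximum.\<close>

definition big_height :: "('a, 'b) ring_scheme \<Rightarrow> 'a set \<Rightarrow> enat" where
  "big_height R I = (SUP P\<in>associated_primes R I. height R P)"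

text \<open>In the following definitions \<open>R\<close> is a subring of the integral domain \<^typ>\<open>'a\<close>, with the
  operations of \<^typ>\<open>'a\<close>. The localization \<open>R\<^sub>P\<close> is realised inside the fraction field of \<^typ>\<open>'a\<close>;
  the canonical map \<open>R \<rightarrow> R\<^sub>P\<close> is \<open>\<lambda>r. Fract r 1\<close>.\<close>

definition localization :: "('a::idom) ring \<Rightarrow> 'a set \<Rightarrow> 'a fract ring" where
  "localization R P = \<lparr>carrier = {Fract a b |a b. a \<in> carrier R \<and> b \<in> carrier R - P},
     mult = (*), one = 1, zero = 0, add = (+)\<rparr>"

text \<open>\<open>J R\<^sub>P\<close> and \<open>J R\<^sub>P \<inter> R\<close>\<close>

definition extension :: "('a::idom) ring \<Rightarrow> 'a set \<Rightarrow> 'a set \<Rightarrow> 'a fract set" where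
  "extension R P J = Idl\<^bsub>localization R P\<^esub> ((\<lambda>r. Fract r 1) ` J)"

definition saturation :: "('a::idom) ring \<Rightarrow> 'a set \<Rightarrow> 'a set \<Rightarrow> 'a set" where
  "saturation R P J = {r \<in> carrier R. Fract r 1 \<in> extension R P J}"

text \<open>The power \<open>J ^ m\<close> is taken in the library's semiring of ideals of \<open>R\<close>, so \<open>J ^ 0 = R\<close>.\<close>

definition symbolic_power :: "('a::idom) ring \<Rightarrow> 'a set \<Rightarrow> nat \<Rightarrow> 'a set" where
  "symbolic_power R J m =
     carrier R \<inter> (\<Inter>P\<in>associated_primes R J. saturation R P (J [^]\<^bsub>ideals_set R\<^esub> m))"

definition waldschmidt_constant :: "nat \<Rightarrow> ('k::idom) mpoly set \<Rightarrow> real" where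
  "waldschmidt_constant n J =
     lim (\<lambda>m. real (initial_degree (symbolic_power (poly_ring n) J m)) / real m)"

lemma cring_poly_ring: "cring (poly_ring n :: ('k::comm_ring_1) mpoly ring)"
proof (rule cringI)
  have add: "f + g \<in> carrier (poly_ring n)"
    if "f \<in> carrier (poly_ring n)" "g \<in> carrier (poly_ring n)" for f g :: "'k mpoly"
    using that Poly_Mapping.keys_add[of f g] by (auto simp: poly_ring_def)
  have mult: "f * g \<in> carrier (poly_ring n)"
    if fg: "f \<in> carrier (poly_ring n)" "g \<in> carrier (poly_ring n)" for f g :: "'k mpoly"
  proof -
    have "t \<in> monomials n" if t: "t \<in> Poly_Mapping.keys (f * g)" for t
    proof -
      obtain a b where "t = a + b" "a \<in> Poly_Mapping.keys f" "b \<in> Poly_Mapping.keys g"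
        using t Poly_Mapping.keys_mult[of f g] by blast
      with fg show ?thesis
        using Poly_Mapping.keys_add[of a b] unfolding poly_ring_def monomials_def by fastforce
    qed
    then show ?thesis by (auto simp: poly_ring_def)
  qed
  show "abelian_group (poly_ring n :: 'k mpoly ring)"
  proof (rule abelian_groupI)
    fix f :: "'k mpoly"
    assume "f \<in> carrier (poly_ring n)"
    then have "- f \<in> carrier (poly_ring n)" "- f \<oplus>\<^bsub>poly_ring n\<^esub> f = \<zero>\<^bsub>poly_ring n\<^esub>"
      by (simp_all add: poly_ring_def)
    then show "\<exists>g\<in>carrier (poly_ring n). g \<oplus>\<^bsub>poly_ring n\<^esub> f = \<zero>\<^bsub>poly_ring n\<^esub>" by blast
  qed (use add in \<open>auto simp: poly_ring_def algebra_simps\<close>)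
  show "Group.comm_monoid (poly_ring n :: 'k mpoly ring)"
    by (rule comm_monoidI)
       (use mult in \<open>auto simp: poly_ring_def algebra_simps monomials_def\<close>)
qed (auto simp: poly_ring_def algebra_simps)

lemma cring_localization:
  assumes P: "primeideal P (poly_ring n :: ('k::idom) mpoly ring)"
  shows "cring (localization (poly_ring n) P)"
proof -
  let ?R = "poly_ring n :: 'k mpoly ring"
  interpret primeideal P ?R by (rule P)
  have nz: "b \<noteq> 0" if "b \<in> carrier ?R - P" for b
    using that additive_subgroup.zero_closed[OF is_additive_subgroup]
    by (auto simp: poly_ring_def)
  have one: "1 \<in> carrier ?R - P"
    using one_closed one_imp_carrier I_notcarr by (auto simp: poly_ring_def)
  have mem: "Fract a b \<in> carrier (localization ?R P)"
    if "a \<in> carrier ?R" "b \<in> carrier ?R - P" for a b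
    using that by (auto simp: localization_def)
  have R_add: "a + b \<in> carrier ?R" and R_mult: "a * b \<in> carrier ?R"
    if "a \<in> carrier ?R" "b \<in> carrier ?R" for a b
    using a_closed[OF that] m_closed[OF that] by (simp_all add: poly_ring_def)
  have S_mult: "a * b \<in> carrier ?R - P" if "a \<in> carrier ?R - P" "b \<in> carrier ?R - P" for a b
    using that R_mult[of a b] I_prime[of a b] by (auto simp: poly_ring_def)
  have add: "x + y \<in> carrier (localization ?R P)"
    and mult: "x * y \<in> carrier (localization ?R P)"
    if xy: "x \<in> carrier (localization ?R P)" "y \<in> carrier (localization ?R P)" for x y
  proof -
    obtain a b c d where *: "x = Fract a b" "y = Fract c d" "a \<in> carrier ?R" "c \<in> carrier ?R"
      "b \<in> carrier ?R - P" "d \<in> carrier ?R - P"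
      using xy by (auto simp: localization_def)
    show "x + y \<in> carrier (localization ?R P)"
      using * nz[of b] nz[of d] by (auto intro!: mem R_add R_mult S_mult simp del: Diff_iff)
    show "x * y \<in> carrier (localization ?R P)"
      using * by (auto intro!: mem R_mult S_mult simp del: Diff_iff)
  qed
  have zero: "0 \<in> carrier (localization ?R P)"
    using mem[of 0 1] one by (simp add: poly_ring_def Zero_fract_def)
  have one': "1 \<in> carrier (localization ?R P)"
    using mem[of 1 1] one by (simp add: One_fract_def)
  have neg: "- x \<in> carrier (localization ?R P)" if x: "x \<in> carrier (localization ?R P)" for x
  proof -
    obtain a b where *: "x = Fract a b" "a \<in> carrier ?R" "b \<in> carrier ?R - P"
      using x by (auto simp: localization_def)
    moreover have "- a \<in> carrier ?R" using *(2) by (simp add: poly_ring_def)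
    ultimately show ?thesis using mem[of "- a" b] by simp
  qed
  show ?thesis
  proof (rule cringI)
    show "abelian_group (localization ?R P)"
    proof (rule abelian_groupI)
      fix x assume "x \<in> carrier (localization ?R P)"
      then show "\<exists>y\<in>carrier (localization ?R P). y \<oplus>\<^bsub>localization ?R P\<^esub> x = \<zero>\<^bsub>localization ?R P\<^esub>"
        using neg[of x] by (intro bexI[of _ "- x"]) (simp_all add: localization_def)
    qed (use add zero in \<open>auto simp: localization_def algebra_simps\<close>)
    show "Group.comm_monoid (localization ?R P)"
      by (rule comm_monoidI) (use mult one' in \<open>auto simp: localization_def algebra_simps\<close>)
  qed (auto simp: localization_def algebra_simps)
qed

end

(* The order of a polynomial along a set E of variables is a valuation, because lowest homogeneous
   parts multiply to something nonzero. Hence it bounds the elements of the m-th symbolic power from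
   below by m whenever the prime (x_j : j in E) is associated to I. Every minimal transversal E of the
   supports of the generators gives such a prime, of height at least |E|, so |E| <= e.
   Now let t be an exponent vector occurring in the m-th symbolic power. The alpha(I) - 1 largest
   entries of t are at positions that contain no support of a generator, hence they miss some minimal
   transversal E. The entries of t on E sum to at least m, so one of them is at least m/e, and so are
   the alpha(I) - 1 larger ones: the degree of t is at least m + (alpha(I) - 1) m / e. *)

theory Submission
  imports Defs
begin

section \<open>Ideals, localization and symbolic powers\<close>

text \<open>Closure under negation comes for free: the additive inverse of a is the product of a
  with the ring element \<open>\<ominus> \<one>\<close>.\<close>

lemma (in cring) ideal_criterion:
  assumes "J \<subseteq> carrier R" "\<zero> \<in> J"
    and "\<And>a b. a \<in> J \<Longrightarrow> b \<in> J \<Longrightarrow> a \<oplus> b \<in> J"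
    and l: "\<And>a x. a \<in> J \<Longrightarrow> x \<in> carrier R \<Longrightarrow> x \<otimes> a \<in> J"
  shows "ideal J R"
proof (rule idealI)
  show "subgroup J (add_monoid R)"
  proof
    fix a assume a: "a \<in> J"
    then have "\<ominus> a = (\<ominus> \<one>) \<otimes> a" using assms(1) by (auto simp: l_minus)
    then show "inv\<^bsub>add_monoid R\<^esub> a \<in> J"
      using l[OF a, of "\<ominus> \<one>"] by (simp add: a_inv_def)
  qed (use assms in auto)
  show "a \<otimes> x \<in> J" if "a \<in> J" "x \<in> carrier R" for a x
    using l[OF that] that assms(1) by (metis m_comm subsetD)
qed (use ring_axioms l in auto)

lemma poly_ring_simps [simp]:
  "mult (poly_ring n) = (*)" "one (poly_ring n) = 1" "zero (poly_ring n) = 0"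
  "add (poly_ring n) = (+)"
  by (simp_all add: poly_ring_def)

lemma localization_simps [simp]:
  "mult (localization R P) = (*)" "one (localization R P) = 1" "zero (localization R P) = 0"
  "add (localization R P) = (+)"
  by (simp_all add: localization_def)

lemma prime_complement:
  fixes P :: "('k::idom) mpoly set"
  assumes "primeideal P (poly_ring n)"
  shows prime_complement_one: "1 \<in> carrier (poly_ring n) - P"
    and prime_complement_nonzero: "\<And>b. b \<in> carrier (poly_ring n) - P \<Longrightarrow> b \<noteq> 0"
    and prime_complement_mult: "\<And>a b. a \<in> carrier (poly_ring n) - P \<Longrightarrow>
      b \<in> carrier (poly_ring n) - P \<Longrightarrow> a * b \<in> carrier (poly_ring n) - P"
proof -
  interpret primeideal P "poly_ring n" by (rule assms)
  show "1 \<in> carrier (poly_ring n) - P"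
    using one_closed one_imp_carrier I_notcarr by auto
  show "b \<noteq> 0" if "b \<in> carrier (poly_ring n) - P" for b
    using that additive_subgroup.zero_closed[OF is_additive_subgroup] by auto
  show "a * b \<in> carrier (poly_ring n) - P"
    if "a \<in> carrier (poly_ring n) - P" "b \<in> carrier (poly_ring n) - P" for a b
    using that I_prime[of a b] m_closed[of a b] by auto
qed

text \<open>Clearing denominators: the fractions with numerator in J and denominator outside P
  already form an ideal of the localization, so they exhaust J R_P. Membership in a symbolic power
  thereby becomes a condition inside R.\<close>

lemma saturation_iff:
  fixes P J :: "('k::idom) mpoly set"
  assumes P: "primeideal P (poly_ring n)" and J: "ideal J (poly_ring n)"
  shows "r \<in> saturation (poly_ring n) P J \<longleftrightarrow>
    r \<in> carrier (poly_ring n) \<and> (\<exists>s\<in>carrier (poly_ring n) - P. s * r \<in> J)"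
proof -
  let ?R = "poly_ring n :: 'k mpoly ring"
  let ?S = "carrier ?R - P"
  let ?L = "localization ?R P"
  let ?K = "{Fract a b | a b. a \<in> J \<and> b \<in> ?S}"
  interpret L: cring ?L by (rule cring_localization[OF P])
  interpret J: ideal J ?R by (rule J)
  note one = prime_complement_one[OF P] and nz = prime_complement_nonzero[OF P]
    and S_mult = prime_complement_mult[OF P]
  have J_add: "a + b \<in> J" if "a \<in> J" "b \<in> J" for a b 
    using additive_subgroup.a_closed[OF J.is_additive_subgroup that] by simp
  have J_mult: "x * a \<in> J" if "a \<in> J" "x \<in> carrier ?R" for a x using J.I_l_closed[OF that] by simp
  have image: "(\<lambda>r. Fract r 1) ` J \<subseteq> carrier ?L"
    using one J.a_subset by (auto simp: localization_def)
  have "ideal ?K ?L"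
  proof (rule L.ideal_criterion)
    show "?K \<subseteq> carrier ?L" using J.a_subset by (auto simp: localization_def)
    show "\<zero>\<^bsub>?L\<^esub> \<in> ?K"
      using one additive_subgroup.zero_closed[OF J.is_additive_subgroup] by (auto simp: Zero_fract_def)
  next
    fix x y assume "x \<in> ?K" "y \<in> ?K"
    then obtain a b c d where *: "x = Fract a b" "y = Fract c d" "a \<in> J" "c \<in> J"
      "b \<in> ?S" "d \<in> ?S" by blast
    have "x + y = Fract (d * a + b * c) (b * d)"
      using * nz[of b] nz[of d] by (simp add: mult.commute)
    moreover have "d * a + b * c \<in> J" using * by (auto intro: J_add J_mult)
    ultimately show "x \<oplus>\<^bsub>?L\<^esub> y \<in> ?K" using S_mult[OF *(5,6)] by auto
  next
    fix x y assume "x \<in> ?K" "y \<in> carrier ?L"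
    then obtain a b c d where *: "x = Fract a b" "y = Fract c d" "a \<in> J" "c \<in> carrier ?R"
      "b \<in> ?S" "d \<in> ?S" unfolding localization_def by auto
    have "y * x = Fract (c * a) (d * b)" using * by simp
    then show "y \<otimes>\<^bsub>?L\<^esub> x \<in> ?K" using S_mult[OF *(6,5)] J_mult[OF *(3,4)] by auto
  qed
  moreover have "(\<lambda>r. Fract r 1) ` J \<subseteq> ?K" using one by blast
  ultimately have sub: "extension ?R P J \<subseteq> ?K"
    unfolding extension_def by (rule L.genideal_minimal)
  interpret E: ideal "extension ?R P J" ?L
    unfolding extension_def by (rule L.genideal_ideal[OF image])
  show ?thesis
  proof (intro iffI conjI)
    assume "r \<in> saturation ?R P J"
    then have r: "r \<in> carrier ?R" "Fract r 1 \<in> ?K" using sub by (auto simp: saturation_def)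
    then obtain a b where ab: "Fract r 1 = Fract a b" "a \<in> J" "b \<in> ?S" by blast
    \<comment> \<open>In a domain, equality of fractions with nonzero denominators is equality of
      the cross products.\<close>
    then have "b * r = a" using nz[of b] by (simp add: eq_fract mult.commute)
    with ab show "\<exists>s\<in>?S. s * r \<in> J" by blast
    show "r \<in> carrier ?R" by (rule r)
  next
    assume "r \<in> carrier ?R \<and> (\<exists>s\<in>?S. s * r \<in> J)"
    then obtain s where s: "r \<in> carrier ?R" "s \<in> ?S" "s * r \<in> J" by blast
    have "Fract (s * r) 1 \<in> extension ?R P J"
      using L.genideal_self[OF image] s(3) by (auto simp: extension_def)
    moreover have "Fract 1 s \<in> carrier ?L" using s(2) one by (auto simp: localization_def)
    ultimately have "Fract 1 s * Fract (s * r) 1 \<in> extension ?R P J"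
      using E.I_l_closed by fastforce
    moreover have "Fract 1 s * Fract (s * r) 1 = Fract r 1"
      using nz[OF s(2)] by (simp add: eq_fract)
    ultimately show "r \<in> saturation ?R P J" using s(1) by (simp add: saturation_def)
  qed
qed

lemma ideals_set_simps [simp]:
  "one (ideals_set R) = carrier R" "mult (ideals_set R) = ideal_prod R"
  by (simp_all add: ideals_set_def)

lemma (in ring) ideal_pow_ideal:
  "ideal J R \<Longrightarrow> ideal (J [^]\<^bsub>ideals_set R\<^esub> (m::nat)) R"
  by (induction m) (auto simp: oneideal intro: ideal_prod_is_ideal)

lemma (in ring) ideal_pow_mult:
  assumes J: "ideal J R" and f: "f \<in> J [^]\<^bsub>ideals_set R\<^esub> (m::nat)"
    and g: "g \<in> J [^]\<^bsub>ideals_set R\<^esub> (m'::nat)"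
  shows "f \<otimes> g \<in> J [^]\<^bsub>ideals_set R\<^esub> (m + m')"
proof -
  have "ideal_prod R (J [^]\<^bsub>ideals_set R\<^esub> m) (J [^]\<^bsub>ideals_set R\<^esub> m') =
      J [^]\<^bsub>ideals_set R\<^esub> (m + m')"
  proof (induction m')
    case 0
    show ?case using ideal_prod_one ideal_pow_ideal[OF J] by simp
  next
    case (Suc m')
    then show ?case
      using ideal_prod_assoc[OF ideal_pow_ideal[OF J] ideal_pow_ideal[OF J] J, of m m']
      by simp
  qed
  then show ?thesis using ideal_prod.prod[OF f g, of R] by simp
qed

lemma symbolic_power_iff:
  fixes J :: "('k::idom) mpoly set"
  assumes "ideal J (poly_ring n)"
  shows "f \<in> symbolic_power (poly_ring n) J m \<longleftrightarrow> f \<in> carrier (poly_ring n) \<and>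
    (\<forall>P\<in>associated_primes (poly_ring n) J.
       \<exists>s\<in>carrier (poly_ring n) - P. s * f \<in> J [^]\<^bsub>ideals_set (poly_ring n)\<^esub> m)"
proof -
  interpret R: cring "poly_ring n :: 'k mpoly ring" by (rule cring_poly_ring)
  have "primeideal P (poly_ring n)" if "P \<in> associated_primes (poly_ring n) J" for P
    using that by (simp add: associated_primes_def)
  then show ?thesis
    using saturation_iff[OF _ R.ideal_pow_ideal[OF assms]]
    by (auto simp: symbolic_power_def)
qed

text \<open>The product of the two multipliers still avoids the prime P. This is what makes the
  initial degrees of the symbolic powers subadditive.\<close>

lemma symbolic_power_mult:
  fixes J :: "('k::idom) mpoly set"
  assumes J: "ideal J (poly_ring n)"
    and f: "f \<in> symbolic_power (poly_ring n) J m" and g: "g \<in> symbolic_power (poly_ring n) J m'"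
  shows "f * g \<in> symbolic_power (poly_ring n) J (m + m')"
proof -
  let ?R = "poly_ring n :: 'k mpoly ring"
  interpret R: cring ?R by (rule cring_poly_ring)
  have "\<exists>s\<in>carrier ?R - P. s * (f * g) \<in> J [^]\<^bsub>ideals_set ?R\<^esub> (m + m')"
    if P: "P \<in> associated_primes ?R J" for P
  proof -
    obtain s s' where s: "s \<in> carrier ?R - P" "s * f \<in> J [^]\<^bsub>ideals_set ?R\<^esub> m"
      "s' \<in> carrier ?R - P" "s' * g \<in> J [^]\<^bsub>ideals_set ?R\<^esub> m'"
      using f g P unfolding symbolic_power_iff[OF J] by blast
    have "s * s' * (f * g) \<in> J [^]\<^bsub>ideals_set ?R\<^esub> (m + m')"
      using R.ideal_pow_mult[OF J s(2,4)] by (simp add: ac_simps)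
    moreover have "s * s' \<in> carrier ?R - P"
      using prime_complement_mult[OF _ s(1,3)] P by (auto simp: associated_primes_def)
    ultimately show ?thesis by blast
  qed
  moreover have "f * g \<in> carrier ?R"
    using f g R.m_closed[of f g] by (auto simp: symbolic_power_iff[OF J])
  ultimately show ?thesis by (simp add: symbolic_power_iff[OF J])
qed

text \<open>The multiplier 1 lies outside every prime. The inclusion serves to exhibit elements of
  symbolic powers.\<close>

lemma ideal_pow_subset_symbolic_power:
  fixes J :: "('k::idom) mpoly set"
  assumes J: "ideal J (poly_ring n)"
  shows "J [^]\<^bsub>ideals_set (poly_ring n)\<^esub> m \<subseteq> symbolic_power (poly_ring n) J m"
proof
  let ?R = "poly_ring n :: 'k mpoly ring"
  interpret R: cring ?R by (rule cring_poly_ring)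
  interpret Jm: ideal "J [^]\<^bsub>ideals_set ?R\<^esub> m" ?R by (rule R.ideal_pow_ideal[OF J])
  fix f assume f: "f \<in> J [^]\<^bsub>ideals_set ?R\<^esub> m"
  have "\<exists>s\<in>carrier ?R - P. s * f \<in> J [^]\<^bsub>ideals_set ?R\<^esub> m"
    if "P \<in> associated_primes ?R J" for P
    using f prime_complement_one[of P n] that
    by (intro bexI[of _ 1]) (auto simp: associated_primes_def)
  then show "f \<in> symbolic_power ?R J m"
    using f Jm.Icarr by (auto simp: symbolic_power_iff[OF J])
qed

section \<open>The order of a polynomial along a set of variables\<close>

definition deg_on :: "nat set \<Rightarrow> (nat \<Rightarrow>\<^sub>0 nat) \<Rightarrow> nat" where
  "deg_on E t = (\<Sum>j\<in>E. Poly_Mapping.lookup t j)"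

text \<open>For \<open>E\<close> inside \<open>{..<n}\<close> this is the m-th power of the prime
  generated by the variables in \<open>E\<close>. Describing it by the exponents that occur turns
  membership into a check term by term.\<close>

definition order_ideal :: "nat \<Rightarrow> nat set \<Rightarrow> nat \<Rightarrow> ('k::comm_ring_1) mpoly set" where
  "order_ideal n E m = {f \<in> carrier (poly_ring n). \<forall>t\<in>Poly_Mapping.keys f. m \<le> deg_on E t}"

lemma deg_on_add: "deg_on E (s + t) = deg_on E s + deg_on E t"
  by (simp add: deg_on_def lookup_add sum.distrib)

lemma monom_degree_eq_deg_on:
  assumes "Poly_Mapping.keys t \<subseteq> A" "finite A"
  shows "monom_degree t = deg_on A t"
  unfolding monom_degree_def deg_on_def using assms
  by (intro sum.mono_neutral_left) (auto simp: in_keys_iff)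

lemma monom_degree_add: "monom_degree (s + t) = monom_degree s + monom_degree t"
  using monom_degree_eq_deg_on[of _ "Poly_Mapping.keys s \<union> Poly_Mapping.keys t"]
    Poly_Mapping.keys_add[of s t]
  by (simp add: deg_on_add)

lemma carrier_poly_ring_iff:
  "f \<in> carrier (poly_ring n) \<longleftrightarrow> Poly_Mapping.keys f \<subseteq> monomials n"
  by (simp add: poly_ring_def)

lemma order_ideal_subset: "order_ideal n E m \<subseteq> carrier (poly_ring n)"
  by (auto simp: order_ideal_def)

lemma order_ideal_0: "order_ideal n E 0 = carrier (poly_ring n)"
  by (auto simp: order_ideal_def)

lemma order_ideal_add:
  assumes "f \<in> order_ideal n E m" "g \<in> order_ideal n E m"
  shows "f + g \<in> order_ideal n E m"
  using assms Poly_Mapping.keys_add[of f g] by (fastforce simp: order_ideal_def carrier_poly_ring_iff)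

lemma order_ideal_mult:
  fixes f g :: "('k::comm_ring_1) mpoly"
  assumes f: "f \<in> order_ideal n E m" and g: "g \<in> order_ideal n E m'"
  shows "f * g \<in> order_ideal n E (m + m')"
proof -
  interpret R: cring "poly_ring n :: 'k mpoly ring" by (rule cring_poly_ring)
  have "m + m' \<le> deg_on E t" if t: "t \<in> Poly_Mapping.keys (f * g)" for t
  proof -
    obtain a b where "t = a + b" "a \<in> Poly_Mapping.keys f" "b \<in> Poly_Mapping.keys g"
      using t Poly_Mapping.keys_mult[of f g] by blast
    with f g show ?thesis by (auto simp: order_ideal_def deg_on_add intro: add_mono)
  qed
  moreover have "f * g \<in> carrier (poly_ring n)"
    using f g R.m_closed[of f g] by (auto simp: order_ideal_def)
  ultimately show ?thesis by (simp add: order_ideal_def)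
qed

lemma ideal_order_ideal: "ideal (order_ideal n E m :: ('k::comm_ring_1) mpoly set) (poly_ring n)"
proof -
  interpret R: cring "poly_ring n :: 'k mpoly ring" by (rule cring_poly_ring)
  show ?thesis
  proof (rule R.ideal_criterion)
    fix f x :: "'k mpoly"
    assume "f \<in> order_ideal n E m" "x \<in> carrier (poly_ring n)"
    then show "x \<otimes>\<^bsub>poly_ring n\<^esub> f \<in> order_ideal n E m"
      using order_ideal_mult[of x n E 0 f m] by (simp add: order_ideal_0)
  qed (auto intro: order_ideal_add order_ideal_subset[THEN subsetD],
       simp add: order_ideal_def carrier_poly_ring_iff)
qed

text \<open>Orders along \<open>E\<close> add up in products and do not drop in sums, and
  \<open>ideal_prod\<close> is built inductively from products and sums.\<close>

lemma ideal_pow_subset_order_ideal: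
  fixes J :: "('k::comm_ring_1) mpoly set"
  assumes J: "J \<subseteq> order_ideal n E 1"
  shows "J [^]\<^bsub>ideals_set (poly_ring n)\<^esub> m \<subseteq> order_ideal n E m"
proof (induction m)
  case 0
  show ?case by (simp add: order_ideal_0)
next
  case (Suc m)
  have "f \<in> order_ideal n E (Suc m)"
    if "f \<in> ideal_prod (poly_ring n) (J [^]\<^bsub>ideals_set (poly_ring n)\<^esub> m) J" for f
    using that
  proof induction
    case (prod i j)
    then show ?case using Suc J order_ideal_mult[of i n E m j 1] by auto
  qed (auto intro: order_ideal_add)
  then show ?case by auto
qed

text \<open>Here \<open>a\<close> is the order of \<open>f\<close> along \<open>E\<close> and
  \<open>p\<close> is its initial form: the terms of least degree in the variables of
  \<open>E\<close>.\<close>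

lemma lowest_part_split:
  fixes f :: "('k::comm_ring_1) mpoly"
  assumes f: "f \<in> carrier (poly_ring n)" "f \<noteq> 0"
  obtains a p q where "f = p + q" "p \<noteq> 0" "p \<in> carrier (poly_ring n)"
    "\<forall>t\<in>Poly_Mapping.keys p. deg_on E t = a" "q \<in> order_ideal n E (Suc a)"
    "f \<in> order_ideal n E a"
proof -
  define a where "a = Min (deg_on E ` Poly_Mapping.keys f)"
  define p where "p = Poly_Mapping.mapp (\<lambda>t c. if deg_on E t = a then c else 0) f"
  define q where "q = Poly_Mapping.mapp (\<lambda>t c. if deg_on E t = a then 0 else c) f"
  have ne: "deg_on E ` Poly_Mapping.keys f \<noteq> {}" using f(2) by simp
  have p: "Poly_Mapping.lookup p t = (if deg_on E t = a then Poly_Mapping.lookup f t else 0)" for t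
    by (auto simp: p_def lookup_mapp when_def in_keys_iff)
  have q: "Poly_Mapping.lookup q t = (if deg_on E t = a then 0 else Poly_Mapping.lookup f t)" for t
    by (auto simp: q_def lookup_mapp when_def in_keys_iff)
  have pq: "f = p + q" by (rule poly_mapping_eqI) (simp add: lookup_add p q)
  have le: "a \<le> deg_on E t" if "t \<in> Poly_Mapping.keys f" for t
    using that by (auto simp: a_def)
  obtain t where "t \<in> Poly_Mapping.keys f" "deg_on E t = a"
    using Min_in[OF _ ne] unfolding a_def by auto
  then have "Poly_Mapping.lookup p t \<noteq> 0" by (simp add: p in_keys_iff)
  then have p0: "p \<noteq> 0" by auto
  have keys: "Poly_Mapping.keys p \<subseteq> Poly_Mapping.keys f"
    "Poly_Mapping.keys q \<subseteq> Poly_Mapping.keys f"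
    by (auto simp: in_keys_iff p q split: if_splits)
  have "Suc a \<le> deg_on E t" if "t \<in> Poly_Mapping.keys q" for t
    using that le[of t] keys by (auto simp: in_keys_iff q split: if_splits)
  then have "q \<in> order_ideal n E (Suc a)"
    using f keys by (auto simp: order_ideal_def carrier_poly_ring_iff)
  moreover have "p \<in> carrier (poly_ring n)"
    using f keys by (auto simp: carrier_poly_ring_iff)
  moreover have "\<forall>t\<in>Poly_Mapping.keys p. deg_on E t = a"
    by (auto simp: in_keys_iff p split: if_splits)
  moreover have "f \<in> order_ideal n E a" using f le by (auto simp: order_ideal_def)
  ultimately show ?thesis using pq p0 that by blast
qed

lemma order_ideal_antimono: "m \<le> m' \<Longrightarrow> order_ideal n E m' \<subseteq> order_ideal n E m"
  by (auto simp: order_ideal_def)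

text \<open>An element outside the prime has order 0 along \<open>E\<close>, and orders add because
  initial forms have a nonzero product in a domain. Hence multiplication by \<open>s\<close> does
  not raise the order of \<open>f\<close>.\<close>

lemma order_ideal_cancel:
  fixes f s :: "('k::idom) mpoly"
  assumes s: "s \<in> carrier (poly_ring n) - order_ideal n E 1" and f: "f \<in> carrier (poly_ring n)"
    and sf: "s * f \<in> order_ideal n E m"
  shows "f \<in> order_ideal n E m"
proof (cases "f = 0")
  case True
  then show ?thesis by (simp add: order_ideal_def carrier_poly_ring_iff)
next
  case False
  from s have "s \<noteq> 0" by (auto simp: order_ideal_def)
  with s obtain a p q where s': "s = p + q" "p \<noteq> 0" "p \<in> carrier (poly_ring n)"
    "\<forall>t\<in>Poly_Mapping.keys p. deg_on E t = a" "q \<in> order_ideal n E (Suc a)"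
    "s \<in> order_ideal n E a"
    using lowest_part_split by (metis DiffD1)
  \<comment> \<open>A positive order would put \<open>s\<close> into the prime that it is assumed to
    avoid.\<close>
  have a: "a = 0" using s s'(6) order_ideal_antimono[of 1 a n E] by (cases a) auto
  obtain b p' q' where f': "f = p' + q'" "p' \<noteq> 0" "p' \<in> carrier (poly_ring n)"
    "\<forall>t\<in>Poly_Mapping.keys p'. deg_on E t = b" "q' \<in> order_ideal n E (Suc b)"
    "f \<in> order_ideal n E b"
    using lowest_part_split[OF f False] .
  have "p * p' \<noteq> 0" using s' f' by simp
  then obtain t where t: "t \<in> Poly_Mapping.keys (p * p')" by (metis keys_eq_empty equals0I)
  have bt: "deg_on E t = b"
    using t Poly_Mapping.keys_mult[of p p'] s'(4) f'(4) a by (auto simp: deg_on_add)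
  have "p * q' \<in> order_ideal n E (Suc b)"
    using order_ideal_mult[of p n E 0 q' "Suc b"] s' f' by (simp add: order_ideal_0)
  moreover have "q * f \<in> order_ideal n E (Suc b)"
    using order_ideal_mult[OF s'(5) f'(6)] a by simp
  ultimately have r: "p * q' + q * f \<in> order_ideal n E (Suc b)" by (rule order_ideal_add)
  \<comment> \<open>The remaining terms all have degree above \<open>b\<close> on \<open>E\<close>,
    so they cannot cancel the term at \<open>t\<close>, which has degree exactly
    \<open>b\<close>.\<close>
  have "t \<notin> Poly_Mapping.keys (p * q' + q * f)"
    using r bt by (auto simp: order_ideal_def)
  moreover have "s * f = p * p' + (p * q' + q * f)"
    by (simp add: s'(1) f'(1) algebra_simps)
  ultimately have "t \<in> Poly_Mapping.keys (s * f)"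
    using t by (simp add: in_keys_iff lookup_add)
  then have "m \<le> b" using sf bt by (auto simp: order_ideal_def)
  then show ?thesis using f'(6) order_ideal_antimono by blast
qed

lemma primeideal_order_ideal:
  "primeideal (order_ideal n E 1 :: ('k::idom) mpoly set) (poly_ring n)"
proof (rule primeidealI[OF ideal_order_ideal cring_poly_ring])
  have "(1 :: 'k mpoly) \<in> carrier (poly_ring n) - order_ideal n E 1"
    by (simp add: order_ideal_def carrier_poly_ring_iff monomials_def deg_on_def)
  then show "carrier (poly_ring n) \<noteq> (order_ideal n E 1 :: 'k mpoly set)" by blast
next
  fix f g :: "'k mpoly"
  assume "f \<in> carrier (poly_ring n)" "g \<in> carrier (poly_ring n)"
    "f \<otimes>\<^bsub>poly_ring n\<^esub> g \<in> order_ideal n E 1"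
  then show "f \<in> order_ideal n E 1 \<or> g \<in> order_ideal n E 1"
    using order_ideal_cancel[of f n E g 1] by auto
qed

lemma single_in_order_ideal_iff:
  "Poly_Mapping.single t (1::'k::comm_ring_1) \<in> order_ideal n E m \<longleftrightarrow>
     t \<in> monomials n \<and> m \<le> deg_on E t"
  by (simp add: order_ideal_def carrier_poly_ring_iff)

lemma deg_on_single: "finite E \<Longrightarrow> deg_on E (Poly_Mapping.single j c) = (if j \<in> E then c else 0)"
  by (simp add: deg_on_def lookup_single when_def)

text \<open>Adjoining the variables of \<open>E\<close> one at a time, starting from the zero ideal,
  gives a strictly increasing chain of primes of length \<open>card E\<close>.\<close>

lemma card_le_height_order_ideal:
  assumes E: "E \<subseteq> {..<n}"
  shows "enat (card E) \<le> height (poly_ring n) (order_ideal n E 1 :: ('k::idom) mpoly set)"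
proof -
  let ?h = "card E"
  have fin: "finite E" using E finite_subset by blast
  obtain g where g: "bij_betw g {..<?h} E"
    using ex_bij_betw_nat_finite[OF fin] by (auto simp: atLeast0LessThan)
  define Q where "Q i = (order_ideal n (g ` {..<i}) 1 :: 'k mpoly set)" for i
  have "Q i \<subset> Q (Suc i)" if i: "i < ?h" for i
  proof
    have "deg_on (g ` {..<i}) t \<le> deg_on (g ` {..<Suc i}) t" for t
      unfolding deg_on_def by (rule sum_mono2) auto
    then show "Q i \<subseteq> Q (Suc i)" unfolding Q_def order_ideal_def by (auto intro: le_trans)
    have "g i \<in> E" using g i by (auto simp: bij_betw_def)
    then have m: "Poly_Mapping.single (g i) 1 \<in> monomials n" using E by (auto simp: monomials_def)
    have ni: "g i \<notin> g ` {..<i}"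
      using g i inj_on_image_mem_iff[of g "{..<?h}" i "{..<i}"] by (auto simp: bij_betw_def)
    \<comment> \<open>The newly adjoined variable separates the two primes; the inner
      \<open>single\<close> is its exponent vector, the outer one the polynomial.\<close>
    have "Poly_Mapping.single (Poly_Mapping.single (g i) 1) 1 \<in> Q (Suc i) - Q i"
      unfolding Q_def using m ni by (simp add: single_in_order_ideal_iff deg_on_single)
    then show "Q i \<noteq> Q (Suc i)" by blast
  qed
  moreover have "Q ?h = order_ideal n E 1" using g by (simp add: Q_def bij_betw_def)
  moreover have "primeideal (Q i) (poly_ring n)" for i
    unfolding Q_def by (rule primeideal_order_ideal)
  ultimately show ?thesis unfolding height_def by (intro SUP_upper) blast
qed

section \<open>Associated primes from minimal transversals\<close>

definition minimal_transversal :: "nat \<Rightarrow> (nat \<Rightarrow>\<^sub>0 nat) set \<Rightarrow> nat set \<Rightarrow> bool" where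
  "minimal_transversal n S E \<longleftrightarrow> E \<subseteq> {..<n} \<and> (\<forall>s\<in>S. Poly_Mapping.keys s \<inter> E \<noteq> {}) \<and>
     (\<forall>j\<in>E. \<exists>s\<in>S. Poly_Mapping.keys s \<inter> E = {j})"

lemma minimal_transversal_exists:
  assumes "F \<subseteq> {..<n}" "\<forall>s\<in>S. Poly_Mapping.keys s \<inter> F \<noteq> {}"
  obtains E where "E \<subseteq> F" "minimal_transversal n S E"
proof -
  let ?T = "{E. E \<subseteq> F \<and> (\<forall>s\<in>S. Poly_Mapping.keys s \<inter> E \<noteq> {})}"
  have "finite F" using assms(1) finite_subset by blast
  then have "finite ?T" by (auto intro: finite_subset[of _ "Pow F"])
  moreover have "F \<in> ?T" using assms by blast
  ultimately obtain E where E: "E \<in> ?T" "\<And>E'. E' \<in> ?T \<Longrightarrow> E' \<subseteq> E \<Longrightarrow> E' = E"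
    using finite_has_minimal[of ?T] by (metis (no_types, lifting) empty_iff)
  have "\<exists>s\<in>S. Poly_Mapping.keys s \<inter> E = {j}" if j: "j \<in> E" for j
  proof -
    \<comment> \<open>Without \<open>j\<close> some support is missed; since \<open>E\<close> itself
      meets that support, it does so exactly in \<open>j\<close>.\<close>
    have "E - {j} \<notin> ?T" using E(2)[of "E - {j}"] j by blast
    then obtain s where "s \<in> S" "Poly_Mapping.keys s \<inter> (E - {j}) = {}" using E(1) by blast
    moreover have "Poly_Mapping.keys s \<inter> E \<noteq> {}" using \<open>s \<in> S\<close> E(1) by blast
    ultimately show ?thesis by blast
  qed
  then have "minimal_transversal n S E"
    using E(1) assms(1) by (auto simp: minimal_transversal_def)
  then show ?thesis using E(1) that by blast
qed

lemma poly_mapping_eq_sum_single: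
  "f = (\<Sum>t\<in>Poly_Mapping.keys f. Poly_Mapping.single t (Poly_Mapping.lookup f t))"
  by (rule poly_mapping_eqI) (auto simp: lookup_sum lookup_single when_def in_keys_iff)

lemma monomial_image_subset:
  "S \<subseteq> squarefree_monomials n \<Longrightarrow>
    (\<lambda>t. Poly_Mapping.single t (1::'k::comm_ring_1)) ` S \<subseteq> carrier (poly_ring n)"
  by (auto simp: carrier_poly_ring_iff squarefree_monomials_def)

lemma squarefree_ideal_subset_order_ideal:
  assumes S: "S \<subseteq> squarefree_monomials n"
    and E: "minimal_transversal n S E"
  shows "Idl\<^bsub>poly_ring n\<^esub> ((\<lambda>t. Poly_Mapping.single t (1::'k::comm_ring_1)) ` S)
    \<subseteq> order_ideal n E 1"
proof -
  interpret R: cring "poly_ring n :: 'k mpoly ring" by (rule cring_poly_ring)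
  have fin: "finite E" using E finite_subset by (auto simp: minimal_transversal_def)
  have "1 \<le> deg_on E s" if s: "s \<in> S" for s
  proof -
    obtain j where "j \<in> E" "j \<in> Poly_Mapping.keys s"
      using E s unfolding minimal_transversal_def by blast
    then show ?thesis
      using member_le_sum[of j E "Poly_Mapping.lookup s"] fin by (simp add: deg_on_def in_keys_iff)
  qed
  then show ?thesis
    using S by (intro R.genideal_minimal ideal_order_ideal)
      (auto simp: single_in_order_ideal_iff squarefree_monomials_def)
qed

text \<open>The prime \<open>(x\<^sub>j)\<^sub>j\<^sub>\<in>\<^sub>E\<close> is the annihilator of the class of the product of the variables outside \<open>E\<close>.\<close>

lemma order_ideal_associated:
  fixes n :: nat and S :: "(nat \<Rightarrow>\<^sub>0 nat) set"
  defines "I \<equiv> Idl\<^bsub>poly_ring n\<^esub> ((\<lambda>t. Poly_Mapping.single t (1::'k::idom)) ` S)"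
  assumes S: "S \<subseteq> squarefree_monomials n" and E: "minimal_transversal n S E"
  shows "order_ideal n E 1 \<in> associated_primes (poly_ring n) I"
proof -
  let ?R = "poly_ring n :: 'k mpoly ring"
  interpret R: cring ?R by (rule cring_poly_ring)
  interpret I: ideal I ?R
    unfolding I_def by (rule R.genideal_ideal[OF monomial_image_subset[OF S]])
  define w :: "nat \<Rightarrow>\<^sub>0 nat" where "w = (\<Sum>j\<in>{..<n} - E. Poly_Mapping.single j 1)"
  have w: "Poly_Mapping.lookup w i = (if i < n \<and> i \<notin> E then 1 else 0)" for i
    by (auto simp: w_def lookup_sum lookup_single when_def)
  define r where "r = Poly_Mapping.single w (1::'k)"
  have wn: "w \<in> monomials n" by (auto simp: monomials_def in_keys_iff w split: if_splits)
  then have rR: "r \<in> carrier ?R" by (simp add: r_def carrier_poly_ring_iff)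
  have "deg_on E w = 0" by (simp add: deg_on_def w)
  then have r: "r \<in> carrier ?R - order_ideal n E 1"
    using rR by (simp add: r_def single_in_order_ideal_iff)
  have "a \<otimes>\<^bsub>?R\<^esub> r \<in> I \<longleftrightarrow> a \<in> order_ideal n E 1" if a: "a \<in> carrier ?R" for a
  proof
    \<comment> \<open>\<open>I\<close> lies in the prime and \<open>r\<close> does not, so
      \<open>r\<close> can be cancelled.\<close>
    assume "a \<otimes>\<^bsub>?R\<^esub> r \<in> I"
    then have "r * a \<in> order_ideal n E 1"
      using squarefree_ideal_subset_order_ideal[OF S E, where 'k = 'k]
      by (auto simp: I_def mult.commute)
    then show "a \<in> order_ideal n E 1" by (rule order_ideal_cancel[OF r a])
  next
    assume aE: "a \<in> order_ideal n E 1"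
    have mono: "Poly_Mapping.single t c * r \<in> I" if t: "t \<in> Poly_Mapping.keys a" for t c
    proof -
      have "deg_on E t \<noteq> 0" using aE t by (auto simp: order_ideal_def)
      then obtain j where j: "j \<in> E" "Poly_Mapping.lookup t j \<noteq> 0"
        unfolding deg_on_def by (meson sum.neutral)
      obtain s where s: "s \<in> S" "Poly_Mapping.keys s \<inter> E = {j}"
        using E j unfolding minimal_transversal_def by blast
      have sn: "Poly_Mapping.keys s \<subseteq> {..<n}" "\<And>i. Poly_Mapping.lookup s i \<le> 1"
        using S s(1) by (auto simp: squarefree_monomials_def monomials_def)
      \<comment> \<open>The private support of \<open>j\<close> yields a generator dividing the
        monomial with exponent \<open>t + w\<close>: \<open>t\<close> covers the exponent at
        \<open>j\<close>, and \<open>w\<close> covers the rest of the support, which lies outside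
        \<open>E\<close>.\<close>
      have le: "Poly_Mapping.lookup s i \<le> Poly_Mapping.lookup (t + w) i" for i
      proof (cases "i \<in> Poly_Mapping.keys s")
        case True
        then have "i = j \<or> (i < n \<and> i \<notin> E)" using s(2) sn(1) by blast
        then show ?thesis using sn(2)[of i] j(2) by (auto simp: lookup_add w)
      qed (simp add: in_keys_iff)
      \<comment> \<open>Subtraction of exponents is truncated; divisibility makes it exact.\<close>
      have u: "(t + w - s) + s = t + w"
        using le by (intro poly_mapping_eqI) (simp add: lookup_add[of _ s] lookup_minus)
      have "t \<in> monomials n" using a t by (auto simp: carrier_poly_ring_iff)
      moreover have "Poly_Mapping.keys (t + w - s) \<subseteq> Poly_Mapping.keys t \<union> Poly_Mapping.keys w"
        by (auto simp: in_keys_iff lookup_minus lookup_add)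
      ultimately have "t + w - s \<in> monomials n" using wn unfolding monomials_def by blast
      then have "Poly_Mapping.single (t + w - s) c \<in> carrier ?R"
        by (simp add: carrier_poly_ring_iff)
      moreover have "Poly_Mapping.single s 1 \<in> I"
        using R.genideal_self[OF monomial_image_subset[OF S]] s(1) by (auto simp: I_def)
      ultimately have "Poly_Mapping.single (t + w - s) c * Poly_Mapping.single s 1 \<in> I"
        using I.I_l_closed[of "Poly_Mapping.single s 1" "Poly_Mapping.single (t + w - s) c"] by simp
      then show ?thesis by (simp add: r_def mult_single u)
    qed
    \<comment> \<open>Partial sums over sets \<open>A\<close> of exponents allow induction; taking
      all keys recovers \<open>a\<close>.\<close>
    have "(\<Sum>t\<in>A. Poly_Mapping.single t (Poly_Mapping.lookup a t)) * r \<in> I"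
      if "A \<subseteq> Poly_Mapping.keys a" for A
      using finite_subset[OF that finite_keys] that
    proof (induction A)
      case empty
      then show ?case using additive_subgroup.zero_closed[OF I.is_additive_subgroup] by simp
    next
      case (insert t A)
      then show ?case
        using additive_subgroup.a_closed[OF I.is_additive_subgroup mono[of t "Poly_Mapping.lookup a t"]]
        by (simp add: distrib_right)
    qed
    from this[OF subset_refl] show "a \<otimes>\<^bsub>?R\<^esub> r \<in> I" by (simp flip: poly_mapping_eq_sum_single)
  qed
  then have "order_ideal n E 1 = {a \<in> carrier ?R. a \<otimes>\<^bsub>?R\<^esub> r \<in> I}"
    using order_ideal_subset by blast
  then show ?thesis
    unfolding associated_primes_def using primeideal_order_ideal rR
    by (intro CollectI conjI bexI[of _ r])
qed

section \<open>Fractional and integral covers\<close>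

text \<open>Greedy choice: extend the set by a heaviest remaining element.\<close>

lemma top_subset_exists:
  fixes y :: "'a \<Rightarrow> nat"
  assumes "finite V" "k \<le> card V"
  shows "\<exists>C\<subseteq>V. card C = k \<and> (\<forall>c\<in>C. \<forall>v\<in>V - C. y v \<le> y c)"
  using assms(2)
proof (induction k)
  case 0
  show ?case by (rule exI[of _ "{}"]) simp
next
  case (Suc k)
  then obtain C where C: "C \<subseteq> V" "card C = k" "\<forall>c\<in>C. \<forall>v\<in>V - C. y v \<le> y c" by auto
  have fin: "finite C" "finite (V - C)" using C(1) assms(1) finite_subset by auto
  have "C \<noteq> V" using Suc.prems C(2) by auto
  then have "y ` (V - C) \<noteq> {}" using C(1) by blast
  then obtain v where v: "v \<in> V - C" "y v = Max (y ` (V - C))"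
    using Max_in[of "y ` (V - C)"] fin by (metis finite_imageI imageE)
  then have "\<forall>u\<in>V - C. y u \<le> y v" using fin by simp
  then have "insert v C \<subseteq> V \<and> card (insert v C) = Suc k \<and>
      (\<forall>c\<in>insert v C. \<forall>u\<in>V - insert v C. y u \<le> y c)"
    using C v fin by auto
  then show ?case by blast
qed

text \<open>The \<open>k\<close> heaviest vertices miss an edge. That edge contributes \<open>m\<close>, and since it has a vertex
  of weight at least \<open>m / e\<close>, so does each of those \<open>k\<close> vertices.\<close>

lemma cover_weight_bound:
  fixes y :: "'a \<Rightarrow> nat"
  assumes V: "finite V"
    and miss: "\<And>C. C \<subseteq> V \<Longrightarrow> card C \<le> k \<Longrightarrow>
      \<exists>E\<subseteq>V. E \<inter> C = {} \<and> card E \<le> e \<and> m \<le> sum y E"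
  shows "m * (e + k) \<le> e * sum y V"
proof (cases "m = 0")
  case False
  \<comment> \<open>Otherwise \<open>C = V\<close> would be admissible, and an edge missing all of
    \<open>V\<close> is empty and cannot have positive weight \<open>m\<close>.\<close>
  have "k \<le> card V"
  proof (rule ccontr)
    assume "\<not> k \<le> card V"
    then obtain E where "E \<subseteq> V" "E \<inter> V = {}" "m \<le> sum y E" using miss[of V] by auto
    moreover from this have "E = {}" by blast
    ultimately show False using False by simp
  qed
  then obtain C where C: "C \<subseteq> V" "card C = k" "\<forall>c\<in>C. \<forall>v\<in>V - C. y v \<le> y c"
    using top_subset_exists[OF V] by metis
  then obtain E where E: "E \<subseteq> V" "E \<inter> C = {}" "card E \<le> e" "m \<le> sum y E" using miss[of C] by auto
  have fin: "finite C" "finite E" using C(1) E(1) V finite_subset by auto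
  \<comment> \<open>Averaging over at most \<open>e\<close> vertices, kept free of division by
    multiplying with \<open>e\<close>.\<close>
  have "\<exists>j\<in>E. m \<le> e * y j"
  proof (rule ccontr)
    assume "\<not> ?thesis"
    then have lt: "\<And>j. j \<in> E \<Longrightarrow> e * y j < m" by auto
    have "E \<noteq> {}" using E(4) False by auto
    then have "(\<Sum>j\<in>E. e * y j) < card E * m"
      using sum_strict_mono[OF fin(2) _ lt] by simp
    also have "\<dots> \<le> e * m" using E(3) by simp
    also have "\<dots> \<le> e * sum y E" using E(4) by simp
    finally show False by (simp add: sum_distrib_left)
  qed
  then obtain j where j: "j \<in> E" "m \<le> e * y j" by blast
  have "m \<le> e * y c" if c: "c \<in> C" for c
  proof -
    have "y j \<le> y c" using C(3) c j(1) E(1,2) by blast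
    then show ?thesis using j(2) by (meson le_trans mult_le_mono2)
  qed
  then have "m * k \<le> (\<Sum>c\<in>C. e * y c)"
    using sum_mono[of C "\<lambda>_. m" "\<lambda>c. e * y c"] C(2) by (simp add: mult.commute)
  \<comment> \<open>The edge \<open>E\<close> accounts for the summand \<open>m * e\<close>, the
    disjoint set \<open>C\<close> of heaviest vertices for \<open>m * k\<close>.\<close>
  then have "m * (e + k) \<le> e * sum y E + e * sum y C"
    using mult_le_mono2[OF E(4), of e] by (simp add: sum_distrib_left algebra_simps)
  also have "\<dots> = e * sum y (E \<union> C)"
    using E(2) fin by (simp add: sum.union_disjoint distrib_left)
  also have "\<dots> \<le> e * sum y V" using C(1) E(1) V by (intro mult_le_mono2 sum_mono2) auto
  finally show ?thesis .
qed simp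

section \<open>Initial degrees and the convergence of their ratios\<close>

lemma single_one_nonzero: "Poly_Mapping.single t (1::'k::zero_neq_one) \<noteq> 0"
  by (simp flip: keys_eq_empty)

lemma initial_degree_le:
  assumes "f \<in> graded_part J d" "f \<noteq> 0"
  shows "initial_degree J \<le> d"
  unfolding initial_degree_def by (rule Least_le) (use assms in auto)

text \<open>An empty graded part also differs from \<open>{0}\<close>; the assumption
  \<open>0 \<in> J\<close> excludes this, so that the least degree really carries a nonzero
  element.\<close>

lemma initial_degree_attained:
  assumes "0 \<in> J" "f \<in> graded_part J d" "f \<noteq> 0"
  obtains g where "g \<in> graded_part J (initial_degree J)" "g \<noteq> 0"
proof -
  have "graded_part J d \<noteq> {0}" using assms by blast
  then have "graded_part J (initial_degree J) \<noteq> {0}" unfolding initial_degree_def by (rule LeastI)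
  moreover have "0 \<in> graded_part J (initial_degree J)" using assms(1) by (simp add: graded_part_def)
  ultimately show ?thesis using that by blast
qed

lemma graded_part_symbolic_power_mult:
  fixes J :: "('k::idom) mpoly set"
  assumes "ideal J (poly_ring n)"
    and "f \<in> graded_part (symbolic_power (poly_ring n) J m) d"
    and "g \<in> graded_part (symbolic_power (poly_ring n) J m') d'"
  shows "f * g \<in> graded_part (symbolic_power (poly_ring n) J (m + m')) (d + d')"
proof -
  have "monom_degree t = d + d'" if t: "t \<in> Poly_Mapping.keys (f * g)" for t
  proof -
    obtain a b where "t = a + b" "a \<in> Poly_Mapping.keys f" "b \<in> Poly_Mapping.keys g"
      using t Poly_Mapping.keys_mult[of f g] by blast
    then show ?thesis using assms(2,3) by (simp add: graded_part_def monom_degree_add)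
  qed
  then show ?thesis
    using assms(2,3) symbolic_power_mult[OF assms(1)] by (simp add: graded_part_def)
qed

text \<open>Fekete's lemma: the ratios tend to their infimum. Division with remainder by a fixed
  \<open>k\<close> bounds \<open>a m\<close> by \<open>m div k\<close> copies of \<open>a k\<close>
  plus a constant.\<close>

lemma fekete_ratio_convergent:
  fixes a :: "nat \<Rightarrow> nat"
  assumes sub: "\<And>m k. a (m + k) \<le> a m + a k"
  shows "convergent (\<lambda>m. real (a m) / real m)"
proof -
  let ?r = "\<lambda>m. real (a m) / real m"
  \<comment> \<open>The index 0 is left out because division by zero would give the ratio 0
    there.\<close>
  define L where "L = (INF m\<in>{1..}. ?r m)"
  have bdd: "bdd_below (?r ` {1..})" by (rule bdd_belowI2[of _ 0]) simp
  have mult: "a (q * k + r) \<le> q * a k + a r" for q k r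
  proof (induction q)
    case (Suc q)
    then show ?case using sub[of k "q * k + r"] by (simp add: add.assoc)
  qed simp
  have "?r \<longlonglongrightarrow> L"
  proof (rule order_tendstoI)
    fix u assume u: "u < L"
    have "u < ?r m" if "m \<ge> 1" for m
      using cINF_lower[OF bdd, of m] that u by (simp add: L_def)
    then show "\<forall>\<^sub>F m in sequentially. u < ?r m" using eventually_ge_at_top[of 1] by (rule eventually_mono[rotated])
  next
    fix u assume "L < u"
    then obtain k where k: "k \<ge> 1" "?r k < u"
      using cINF_less_iff[OF _ bdd, of u] by (auto simp: L_def)
    \<comment> \<open>\<open>M\<close> bounds the contribution \<open>a (m mod k)\<close> of every
      possible remainder, uniformly in \<open>m\<close>.\<close>
    define M where "M = (\<Sum>r<k. a r)"
    have le: "?r m \<le> ?r k + real M / real m" if m: "m \<ge> 1" for m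
    proof -
      have "a (m mod k) \<le> M"
        using k(1) unfolding M_def by (intro member_le_sum) auto
      then have "a m \<le> (m div k) * a k + M"
        using mult[of "m div k" k "m mod k"] by simp
      then have "real (a m) \<le> real (m div k) * real (a k) + real M"
        by (metis of_nat_add of_nat_le_iff of_nat_mult)
      also have "real (m div k) * real (a k) \<le> (real m / real k) * real (a k)"
        by (intro mult_right_mono of_nat_div_le_of_nat) simp
      finally show ?thesis using m by (simp add: field_simps)
    qed
    have "(\<lambda>m. ?r k + real M / real m) \<longlonglongrightarrow> ?r k + 0"
      by (intro tendsto_intros lim_const_over_n)
    then have "\<forall>\<^sub>F m in sequentially. ?r k + real M / real m < u"
      using k(2) by (intro order_tendstoD) auto
    then show "\<forall>\<^sub>F m in sequentially. ?r m < u"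
      using eventually_ge_at_top[of 1] by eventually_elim (use le in force)
  qed
  then show ?thesis by (rule convergentI)
qed

theorem theorem1p2:
  fixes n e :: nat and I :: "('k::alg_closed_field) mpoly set"
  assumes "squarefree_monomial_ideal n I"
    and "I \<noteq> {0}" and "I \<noteq> carrier (poly_ring n)"
    and "big_height (poly_ring n) I = enat e"
  shows "waldschmidt_constant n I \<ge> (real (initial_degree I) + real e - 1) / real e"
proof -
  let ?R = "poly_ring n :: 'k mpoly ring"
  interpret R: cring ?R by (rule cring_poly_ring)
  obtain S where S: "S \<subseteq> squarefree_monomials n"
    and I_def: "I = Idl\<^bsub>?R\<^esub> ((\<lambda>t. Poly_Mapping.single t 1) ` S)"
    using assms(1) by (auto simp: squarefree_monomial_ideal_def)
  have I: "ideal I ?R" unfolding I_def by (rule R.genideal_ideal[OF monomial_image_subset[OF S]])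
  then interpret I: ideal I ?R .
  have gen: "Poly_Mapping.single s 1 \<in> I" if "s \<in> S" for s
    using R.genideal_self[OF monomial_image_subset[OF S]] that by (auto simp: I_def)
  have "S \<noteq> {}"
  proof
    assume "S = {}"
    then have "I \<subseteq> {0}" using R.genideal_minimal[OF R.zeroideal, of "{}"] by (simp add: I_def)
    then show False using assms(2) additive_subgroup.zero_closed[OF I.is_additive_subgroup] by auto
  qed
  then obtain s0 where s0: "s0 \<in> S" by blast
  define \<alpha> where "\<alpha> = initial_degree I"
  let ?sp = "symbolic_power ?R I"
  define a where "a m = initial_degree (?sp m)" for m

  \<comment> \<open>A support has at least \<alpha> elements, since its squarefree generator has
    that degree. Hence \<open>C\<close> contains no support, and the complement of \<open>C\<close>
    is a transversal.\<close>
  have miss: "\<exists>E. minimal_transversal n S E \<and> E \<inter> C = {}"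
    if C: "C \<subseteq> {..<n}" "card C \<le> \<alpha> - 1" for C
  proof -
    have "\<not> Poly_Mapping.keys s \<subseteq> C" if s: "s \<in> S" for s
    proof
      assume sub: "Poly_Mapping.keys s \<subseteq> C"
      have "finite C" using C(1) finite_subset by blast
      then have "card (Poly_Mapping.keys s) \<le> \<alpha> - 1" using card_mono[OF _ sub] C(2) by linarith
      moreover have "monom_degree s \<le> card (Poly_Mapping.keys s)"
        unfolding monom_degree_def
        using S s sum_mono[of "Poly_Mapping.keys s" "Poly_Mapping.lookup s" "\<lambda>_. 1"]
        by (auto simp: squarefree_monomials_def)
      moreover have "\<alpha> \<le> monom_degree s" unfolding \<alpha>_def
        by (rule initial_degree_le[of "Poly_Mapping.single s 1"])
          (use gen[OF s] in \<open>simp_all add: graded_part_def single_one_nonzero\<close>)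
      \<comment> \<open>With truncated subtraction the bounds leave only \<alpha> = 0 and an empty
        support; then \<open>I\<close> would contain 1, although it is proper.\<close>
      ultimately have "card (Poly_Mapping.keys s) = 0" by linarith
      then have "s = 0" by simp
      then have "1 \<in> I" using gen[OF s] by simp
      then show False using I.one_imp_carrier assms(3) by simp
    qed
    moreover have "Poly_Mapping.keys s \<subseteq> {..<n}" if "s \<in> S" for s
      using that S by (auto simp: squarefree_monomials_def monomials_def)
    ultimately have "\<forall>s\<in>S. Poly_Mapping.keys s \<inter> ({..<n} - C) \<noteq> {}" by blast
    from minimal_transversal_exists[OF Diff_subset this] obtain E
      where "E \<subseteq> {..<n} - C" "minimal_transversal n S E" .
    then show ?thesis by (intro exI[of _ E]) auto
  qed

  have card_le: "card E \<le> e" if E: "minimal_transversal n S E" for E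
  proof -
    have "enat (card E) \<le> height ?R (order_ideal n E 1)"
      using E by (intro card_le_height_order_ideal) (simp add: minimal_transversal_def)
    also have "\<dots> \<le> big_height ?R I"
      unfolding big_height_def I_def by (intro SUP_upper order_ideal_associated S E)
    finally show ?thesis using assms(4) by simp
  qed

  \<comment> \<open>Localizing at the prime of \<open>E\<close> gives a multiplier outside it that
    brings \<open>f\<close> into the ordinary power; cancelling the multiplier preserves the order
    bound.\<close>
  have order: "f \<in> order_ideal n E m"
    if E: "minimal_transversal n S E" and f: "f \<in> ?sp m" for E f m
  proof -
    have ass: "order_ideal n E 1 \<in> associated_primes ?R I"
      unfolding I_def by (rule order_ideal_associated[OF S E])
    have "f \<in> carrier ?R"
      and "\<exists>s\<in>carrier ?R - order_ideal n E 1. s * f \<in> I [^]\<^bsub>ideals_set ?R\<^esub> m"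
      using f[unfolded symbolic_power_iff[OF I]] ass by auto
    then obtain s where s: "s \<in> carrier ?R - order_ideal n E 1"
      "s * f \<in> I [^]\<^bsub>ideals_set ?R\<^esub> m" by (elim bexE)
    have "I \<subseteq> order_ideal n E 1"
      unfolding I_def by (rule squarefree_ideal_subset_order_ideal[OF S E])
    then have "s * f \<in> order_ideal n E m" using ideal_pow_subset_order_ideal s(2) by blast
    then show ?thesis by (rule order_ideal_cancel[OF s(1) \<open>f \<in> carrier ?R\<close>])
  qed

  \<comment> \<open>The covering bound is applied to the entries of one exponent vector
    \<open>t\<close> of \<open>f\<close>, with \<open>k\<close> equal to \<alpha> - 1 and minimal
    transversals as edges.\<close>
  have bound: "m * (e + (\<alpha> - 1)) \<le> e * d"
    if f: "f \<in> graded_part (?sp m) d" "f \<noteq> 0" for f m d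
  proof -
    obtain t where t: "t \<in> Poly_Mapping.keys f" using f(2) by (metis keys_eq_empty equals0I)
    have f': "f \<in> ?sp m" using f(1) by (simp add: graded_part_def)
    have "t \<in> monomials n"
      using f' t by (auto simp: symbolic_power_def carrier_poly_ring_iff)
    then have d: "d = sum (Poly_Mapping.lookup t) {..<n}"
      using f(1) t monom_degree_eq_deg_on[of t "{..<n}"]
      by (auto simp: graded_part_def monomials_def deg_on_def)
    have "\<exists>E\<subseteq>{..<n}. E \<inter> C = {} \<and> card E \<le> e \<and> m \<le> sum (Poly_Mapping.lookup t) E"
      if C: "C \<subseteq> {..<n}" "card C \<le> \<alpha> - 1" for C
    proof -
      obtain E where E: "minimal_transversal n S E" "E \<inter> C = {}" using miss[OF C] by blast
      have "m \<le> deg_on E t" using order[OF E(1) f'] t by (auto simp: order_ideal_def)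
      then show ?thesis
        using E card_le[OF E(1)] by (intro exI[of _ E]) (simp add: minimal_transversal_def deg_on_def)
    qed
    then show ?thesis unfolding d by (intro cover_weight_bound) auto
  qed

  have zero: "0 \<in> ?sp m" for m
    using ideal_pow_subset_symbolic_power[OF I, of m]
      additive_subgroup.zero_closed[OF ideal.axioms(1)[OF R.ideal_pow_ideal[OF I, of m]]] by auto
  \<comment> \<open>Homogeneous nonzero elements come from 1 by repeated multiplication with the
    generator of exponent \<open>s0\<close>; they ensure that each \<open>LEAST\<close> in
    \<open>a m\<close> is attained.\<close>
  have ex: "\<exists>d f. f \<in> graded_part (?sp m) d \<and> f \<noteq> 0" for m
  proof (induction m)
    case 0
    have "1 \<in> graded_part (?sp 0) 0"
      using ideal_pow_subset_symbolic_power[OF I, of 0] R.one_closed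
      by (auto simp: graded_part_def monom_degree_def)
    then show ?case by (metis zero_neq_one)
  next
    case (Suc m)
    then obtain d f where f: "f \<in> graded_part (?sp m) d" "f \<noteq> 0" by blast
    let ?g = "Poly_Mapping.single s0 (1::'k)"
    have "?g \<in> I [^]\<^bsub>ideals_set ?R\<^esub> (1::nat)"
      using ideal_prod.prod[of 1 "carrier ?R" ?g I ?R] R.one_closed gen[OF s0] by simp
    then have "?g \<in> graded_part (?sp 1) (monom_degree s0)"
      using ideal_pow_subset_symbolic_power[OF I, of 1] by (auto simp: graded_part_def)
    then have "f * ?g \<in> graded_part (?sp (m + 1)) (d + monom_degree s0)"
      by (rule graded_part_symbolic_power_mult[OF I f(1)])
    moreover have "f * ?g \<noteq> 0" using f(2) single_one_nonzero by (rule no_zero_divisors)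
    ultimately show ?case unfolding Suc_eq_plus1 by blast
  qed
  have att: "\<exists>g\<in>graded_part (?sp m) (a m). g \<noteq> 0" for m
  proof -
    obtain d f where "f \<in> graded_part (?sp m) d" "f \<noteq> 0" using ex by blast
    from initial_degree_attained[OF zero this] show ?thesis unfolding a_def by blast
  qed
  have "a (m + k) \<le> a m + a k" for m k
  proof -
    obtain f g where fg: "f \<in> graded_part (?sp m) (a m)" "f \<noteq> 0"
      "g \<in> graded_part (?sp k) (a k)" "g \<noteq> 0" using att by blast
    then have "f * g \<noteq> 0" by simp
    then show ?thesis
      unfolding a_def[of "m + k"]
      by (rule initial_degree_le[OF graded_part_symbolic_power_mult[OF I fg(1,3)]])
  qed
  \<comment> \<open>\<open>lim\<close> denotes an actual limit only once convergence is
    known.\<close>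
  then have "(\<lambda>m. real (a m) / real m) \<longlonglongrightarrow> waldschmidt_constant n I"
    unfolding waldschmidt_constant_def a_def[symmetric]
    by (intro convergent_LIMSEQ_iff[THEN iffD1] fekete_ratio_convergent)
  moreover have "(real \<alpha> + real e - 1) / real e \<le> real (a m) / real m" if m: "m \<ge> 1" for m
  \<comment> \<open>For \<open>e = 0\<close> division by zero makes the left-hand side 0.\<close>
  proof (cases "e = 0")
    case False
    have "m * (e + (\<alpha> - 1)) \<le> e * a m" using att[of m] bound by blast
    then have "real m * (real e + real (\<alpha> - 1)) \<le> real e * real (a m)"
      by (metis of_nat_add of_nat_le_iff of_nat_mult)
    \<comment> \<open>Truncated subtraction can only enlarge \<alpha> - 1, so the inequality
      survives the passage to the reals.\<close>
    moreover have "real m * (real \<alpha> + real e - 1) \<le> real m * (real e + real (\<alpha> - 1))"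
      by (rule mult_left_mono) auto
    ultimately show ?thesis using False m by (simp add: field_simps)
  qed simp
  ultimately show ?thesis
    unfolding \<alpha>_def by (intro LIMSEQ_le_const) auto
qed

end
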